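(* Let $U$ be a tree topology and let $U'$ be any extension of $U$. If the polyhedron of the STT LP for $U$ has a non-integer vertex, then so does the polyhedron of the STT LP for $U'$. The same holds when only the depths are considered: if the projection of the LP polyhedron of $U$ onto the $D$ coordinates has a non-integer vertex, then so does the corresponding projection for $U'$.
   Context: A single extension of a tree $G$ to $G'$ adds one new node to $G$ either as a new leaf attached to an existing node or by subdividing an existing edge into two edges through the new node. $G$ extends $H$ if there is a sequence of $|G|-|H|$ single extensions $H\to H'\to\dots\to G$. For a tree $U$ and distinct nodes $i,j$, $(i\leftrightsquigarrow j)$ denotes the nodes strictly between $i$ and $j$ on the $U$-path. The STT LP for $U$ has variables $D_i$, $X_{ij}$ ($i\ne j$), $Z_{kij}=Z_{kji}$ ($k\in(i\leftrightsquigarrow j)$); constraints $X,Z\ge0$; $X_{ij}+X_{ji}+\sum_{k\in(i\leftrightsquigarrow j)}Z_{kij}\ge1$ for all $i\ne j$; $Z_{kij}\le X_{ki}$, $Z_{kij}\le X_{kj}$; $D_i\ge\sum_{j\ne i}X_{ji}$. *)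

theory Defs
  imports "HOL-Analysis.Analysis" "Graph_Theory.Digraph_Component"
begin

text \<open>
  Undirected graphs are symmetric pair digraphs. The predicate \<open>tree\<close> of the graph library
  forbids directed cycles only: it rejects every symmetric graph with an edge and accepts
  acyclically oriented triangles. In a symmetric loop-free digraph without parallel arcs, the
  cycles of the underlying undirected graph are the directed cycles of length at least 3.
\<close>

definition undirected_tree :: "'v pair_pre_digraph \<Rightarrow> bool" where
  "undirected_tree U \<longleftrightarrow>
     pair_graph U \<and> Digraph_Component.connected (with_proj U) \<and>
     \<not> (\<exists>p. pre_digraph.cycle (with_proj U) p \<and> 3 \<le> length p)"

inductive single_extension :: "'v pair_pre_digraph \<Rightarrow> 'v pair_pre_digraph \<Rightarrow> bool"
  for G :: "'v pair_pre_digraph" where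
  leaf: "u \<in> pverts G \<Longrightarrow> w \<notin> pverts G \<Longrightarrow>
    single_extension G
      \<lparr> pverts = insert w (pverts G), parcs = parcs G \<union> {(u, w), (w, u)} \<rparr>"
| subdivision: "(u, v) \<in> parcs G \<Longrightarrow> w \<notin> pverts G \<Longrightarrow>
    single_extension G (subdivide G (u, v) w)"

definition extends :: "'v pair_pre_digraph \<Rightarrow> 'v pair_pre_digraph \<Rightarrow> bool"
  (infix \<open>extends\<close> 50) where
  "G extends H \<longleftrightarrow> (single_extension ^^ (card (pverts G) - card (pverts H))) H G"

definition between :: "'v pair_pre_digraph \<Rightarrow> 'v \<Rightarrow> 'v \<Rightarrow> 'v set" where
  "between U i j =
     {k. k \<noteq> i \<and> k \<noteq> j \<and>
         (\<exists>p. pre_digraph.apath (with_proj U) i p j \<and> k \<in> set (pawalk_verts i p))}"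

text \<open>
  All trees live on subsets of one finite ambient type, so that a tree and its extensions have
  their polyhedra in the same space. Coordinates that are not variables of the LP are fixed to 0,
  and the two names of the variable \<open>Z\<^bsub>kij\<^esub> = Z\<^bsub>kji\<^esub>\<close> are identified by an
  equation.
\<close>

definition stt_polyhedron ::
    "'v::finite pair_pre_digraph \<Rightarrow> ((real^'v) \<times> (real^'v^'v) \<times> (real^'v^'v^'v)) set" where
  "stt_polyhedron U = {(D, X, Z).
     (\<forall>i. i \<notin> pverts U \<longrightarrow> D $ i = 0) \<and>
     (\<forall>i j. \<not> (i \<in> pverts U \<and> j \<in> pverts U \<and> i \<noteq> j) \<longrightarrow> X $ i $ j = 0) \<and>
     (\<forall>k i j. \<not> (i \<in> pverts U \<and> j \<in> pverts U \<and> i \<noteq> j \<and> k \<in> between U i j) \<longrightarrow>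
        Z $ k $ i $ j = 0) \<and>
     (\<forall>i\<in>pverts U. \<forall>j\<in>pverts U. i \<noteq> j \<longrightarrow>
        0 \<le> X $ i $ j \<and>
        1 \<le> X $ i $ j + X $ j $ i + (\<Sum>k\<in>between U i j. Z $ k $ i $ j) \<and>
        (\<forall>k\<in>between U i j.
           Z $ k $ i $ j = Z $ k $ j $ i \<and>
           0 \<le> Z $ k $ i $ j \<and> Z $ k $ i $ j \<le> X $ k $ i \<and> Z $ k $ i $ j \<le> X $ k $ j)) \<and>
     (\<forall>i\<in>pverts U. (\<Sum>j\<in>pverts U - {i}. X $ j $ i) \<le> D $ i)}"

definition depth_projection :: "'v::finite pair_pre_digraph \<Rightarrow> (real^'v) set" where
  "depth_projection U = fst ` stt_polyhedron U"

text \<open>The inner products with \<open>Basis\<close> are the standard coordinates.\<close>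

definition has_noninteger_vertex :: "'a::euclidean_space set \<Rightarrow> bool" where
  "has_noninteger_vertex S \<longleftrightarrow> (\<exists>x. x extreme_point_of S \<and> (\<exists>b\<in>Basis. x \<bullet> b \<notin> \<int>))"

end

theory Submission
  imports Defs
begin

text \<open>
  It suffices to treat a single extension of \<open>G\<close> to \<open>G'\<close> by a node \<open>w\<close>; let \<open>u\<close> be its
  attachment point or one end of the subdivided edge. Merging \<open>w\<close> into \<open>u\<close>, by adding the
  variables \<open>X\<^bsub>wj\<^esub>\<close> and \<open>Z\<^bsub>wij\<^esub>\<close> to \<open>X\<^bsub>uj\<^esub>\<close> and \<open>Z\<^bsub>uij\<^esub>\<close>, is a linear map of the polyhedron
  of \<open>G'\<close> into that of \<open>G\<close> which does not change the depths of the old nodes. Conversely, a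
  point for \<open>G\<close> lifts to \<open>G'\<close> by placing \<open>w\<close> below all other nodes.

  The fibre of a linear map over a vertex is a face, so it remains to find a vertex of the
  fibre. For the polyhedron itself the lift is one, because the constraints on \<open>w\<close> that it
  satisfies with equality determine all coordinates involving \<open>w\<close>. For the depths the fibre is
  a ray in the direction of \<open>D\<^bsub>w\<^esub>\<close>, whose end point exists by compactness.
\<close>

section \<open>Paths in extensions\<close>

text \<open>Each traversal of the subdivided edge becomes a detour through \<open>w\<close> with the
  same ends, so no visited node is lost. This is true of arbitrary arc lists, so the induction
  carries no walk hypothesis.\<close>

lemma set_pawalk_verts_sd_path:
  "set (pawalk_verts u p) \<subseteq> set (pawalk_verts u (sd_path (x, y) w p))"
proof (induct p arbitrary: u)
  case Nil
  show ?case by (simp only: sd_path.simps)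
next
  case (Cons e es)
  note simps = sd_path.simps pawalk_verts.simps append.simps list.set fst_conv snd_conv
    if_True if_False simp_thms
  consider "e = (x, y)" | "e \<noteq> (x, y)" "e = (y, x)" | "e \<noteq> (x, y)" "e \<noteq> (y, x)" by blast
  then show ?case
  proof cases
    case 1
    then show ?thesis using Cons[of y] by (simp only: simps) blast
  next
    case 2
    then show ?thesis using Cons[of x] by (simp only: simps) blast
  next
    case 3
    then show ?thesis using Cons[of "snd e"] by (simp only: simps) blast
  qed
qed

text \<open>A path repeats no node, so it enters and leaves an inner node through different
  neighbours. Hence a new leaf, having one neighbour, is never inner, and a path with a subdividing
  node inside visits both ends of the old edge.\<close>

lemma (in pair_sym_digraph) apath_inner_neighbours:
  assumes "apath i p j" "i \<noteq> k" "j \<noteq> k" "k \<in> set (awalk_verts i p)"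
  obtains a b where "a \<noteq> b" "(a, k) \<in> parcs G" "(k, b) \<in> parcs G"
    "a \<in> set (awalk_verts i p)" "b \<in> set (awalk_verts i p)"
proof -
  have "\<exists>a b. a \<noteq> b \<and> (a, k) \<in> parcs G \<and> (k, b) \<in> parcs G \<and>
    a \<in> set (awalk_verts i p) \<and> b \<in> set (awalk_verts i p)"
    using assms
  proof (induct p arbitrary: i)
    case Nil
    then show ?case by auto
  next
    case (Cons e es)
    have e: "e \<in> parcs G" "i = fst e" "apath (snd e) es j"
      "i \<notin> set (awalk_verts (snd e) es)"
      using Cons.prems(1) by (auto simp: apath_Cons_iff)
    show ?case
    proof (cases "snd e = k")
      case False
      then have "k \<in> set (awalk_verts (snd e) es)" using Cons.prems e by auto
      from Cons.hyps[OF e(3) False Cons.prems(3) this] show ?thesis by fastforce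
    next
      case True
      then obtain e' es' where es: "es = e' # es'"
        using e(3) Cons.prems(3) by (cases es) (auto simp: apath_Nil_iff)
      have e': "e' \<in> parcs G" "k = fst e'" "apath (snd e') es' j"
        using e(3) True es by (auto simp: apath_Cons_iff)
      have "snd e' \<in> set (awalk_verts (snd e') es')"
        by (cases es') (use e'(3) in \<open>auto simp: apath_Cons_iff\<close>)
      \<comment> \<open>The path starts \<open>i\<close>, \<open>k\<close>, \<open>snd e'\<close>,
        and \<open>i\<close> does not recur after the first arc.\<close>
      then have "fst e \<noteq> snd e'" "snd e' \<in> set (awalk_verts i (e # es))" using e es by auto
      moreover have "(fst e, k) \<in> parcs G" "(k, snd e') \<in> parcs G"
        using e(1) e'(1,2) True by (metis prod.collapse)+
      moreover have "fst e \<in> set (awalk_verts i (e # es))" by simp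
      ultimately show ?thesis by blast
    qed
  qed
  then show ?thesis using that by blast
qed

lemma pair_sym_digraph_single_extension:
  assumes "pair_sym_digraph G" "single_extension G G'"
  shows "pair_sym_digraph G'"
  using assms(2)
proof cases
  case (leaf u w)
  interpret pair_sym_digraph G by fact
  have "sym (parcs G')"
    using leaf arcs_symmetric unfolding sym_def by fastforce
  then show ?thesis
    using leaf by unfold_locales (auto simp: symmetric_def dest: in_arcsD1 in_arcsD2)
next
  case (subdivision u v w)
  then show ?thesis
    using assms(1) by (simp add: pair_sym_digraph.pair_sym_digraph_subdivide)
qed

text \<open>Paths translate in both directions, by \<open>sd_path\<close> and
  \<open>co_path\<close>; only \<open>w\<close> can appear or disappear on the way.\<close>

lemma between_subdivide:
  assumes "pair_sym_digraph G" "(u, v) \<in> parcs G" "w \<notin> pverts G"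
    and "i \<in> pverts G" "j \<in> pverts G"
  shows "between (subdivide G (u, v) w) i j - {w} = between G i j"
proof -
  interpret pair_sym_digraph G by fact
  interpret S: pair_sym_digraph "subdivide G (u, v) w"
    using assms by (intro pair_sym_digraph_subdivide)
  have "k \<in> between G i j" if "k \<in> between (subdivide G (u, v) w) i j - {w}" for k
    using that apath_co_path[OF assms(2-5)] set_awalk_verts_co_path[OF assms(2-5)]
    unfolding between_def by auto
  moreover have "k \<in> between (subdivide G (u, v) w) i j - {w}" if "k \<in> between G i j" for k
  proof -
    from that obtain p where p: "k \<noteq> i" "k \<noteq> j" "apath i p j" "k \<in> set (awalk_verts i p)"
      unfolding between_def by auto
    have "k \<in> pverts G"
      using p awalkI_apath awalk_verts_in_verts unfolding awalk_def by blast
    moreover have "k \<in> set (awalk_verts i (sd_path (u, v) w p))"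
      using p(4) set_pawalk_verts_sd_path by fastforce
    ultimately show ?thesis
      using p apath_sd_path[OF p(3) assms(2,3)] assms(3) unfolding between_def by auto
  qed
  ultimately show ?thesis by blast
qed

text \<open>The only neighbours of \<open>w\<close> are \<open>u\<close> and \<open>v\<close>, so a
  path with \<open>w\<close> inside visits \<open>u\<close>, which is neither end and hence strictly
  between them.\<close>

lemma new_node_between_subdivide:
  assumes "pair_sym_digraph G" "(u, v) \<in> parcs G" "w \<notin> pverts G"
    and "i \<in> pverts G" "j \<in> pverts G" "i \<noteq> u" "j \<noteq> u"
    and "w \<in> between (subdivide G (u, v) w) i j"
  shows "u \<in> between G i j"
proof -
  interpret pair_sym_digraph G by fact
  interpret S: pair_sym_digraph "subdivide G (u, v) w"
    using assms by (intro pair_sym_digraph_subdivide)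
  from assms(8) obtain p where p: "w \<noteq> i" "w \<noteq> j" "S.apath i p j" "w \<in> set (awalk_verts i p)"
    unfolding between_def by auto
  obtain a b where ab: "a \<noteq> b" "(a, w) \<in> parcs (subdivide G (u, v) w)"
    "(w, b) \<in> parcs (subdivide G (u, v) w)"
    "a \<in> set (awalk_verts i p)" "b \<in> set (awalk_verts i p)"
    using S.apath_inner_neighbours[OF p(3)] p by metis
  then have "u \<in> set (awalk_verts i p)"
    using assms(3) by (auto dest: in_arcsD1 in_arcsD2)
  then have "u \<in> between (subdivide G (u, v) w) i j"
    using p assms(6,7) unfolding between_def by auto
  then show ?thesis
    using between_subdivide[OF assms(1-5)] assms(2,3) in_arcsD1 by blast
qed

text \<open>A path between old nodes cannot pass through \<open>w\<close>, whose only neighbour is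
  \<open>u\<close>, so it uses old arcs only.\<close>

lemma between_leaf:
  assumes "pair_sym_digraph G" "u \<in> pverts G" "w \<notin> pverts G"
    and "i \<in> pverts G" "j \<in> pverts G"
  shows "between \<lparr>pverts = insert w (pverts G), parcs = parcs G \<union> {(u, w), (w, u)}\<rparr> i j
    = between G i j" (is "between ?G' i j = _")
proof -
  interpret pair_sym_digraph G by fact
  have "single_extension G ?G'" using assms by (intro single_extension.leaf)
  then interpret S: pair_sym_digraph ?G'
    using assms(1) by (rule pair_sym_digraph_single_extension[rotated])
  have "S.apath i p j \<longleftrightarrow> apath i p j" for p
  proof
    assume p: "S.apath i p j"
    have w: "w \<notin> set (awalk_verts i p)"
    proof
      assume "w \<in> set (awalk_verts i p)"
      moreover have "i \<noteq> w" "j \<noteq> w" using assms by auto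
      ultimately obtain a b where "a \<noteq> b" "(a, w) \<in> parcs ?G'" "(w, b) \<in> parcs ?G'"
        using S.apath_inner_neighbours[OF p] by metis
      then show False using assms(3) by (auto dest: in_arcsD1 in_arcsD2)
    qed
    have aw: "S.awalk i p j" using p by (rule S.awalkI_apath)
    have "e \<in> parcs G" if "e \<in> set p" for e
    proof -
      have "fst e \<in> set (awalk_verts i p)" "snd e \<in> set (awalk_verts i p)"
        using S.awalk_verts_arc1[OF that] S.awalk_verts_arc2[OF aw that] by auto
      moreover have "e \<in> parcs ?G'" using aw that unfolding S.awalk_def by auto
      ultimately show ?thesis using w by auto
    qed
    then show "apath i p j"
      using p assms(4) unfolding S.apath_def apath_def S.awalk_def awalk_def by auto
  next
    assume "apath i p j"
    then show "S.apath i p j"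
      unfolding S.apath_def apath_def S.awalk_def awalk_def by auto
  qed
  then show ?thesis unfolding between_def by simp
qed

text \<open>Common interface of both kinds of extension. The anchor \<open>u\<close> will absorb
  \<open>w\<close>; \<open>between_new\<close> ensures that a variable \<open>Z $ w $ i $ j\<close>
  with old ends other than \<open>u\<close> has a variable \<open>Z $ u $ i $ j\<close> of
  \<open>G\<close> to be added to.\<close>

locale node_insertion =
  fixes G G' :: "'v::finite pair_pre_digraph" and w u :: 'v
  assumes verts: "pverts G' = insert w (pverts G)"
    and new_notin: "w \<notin> pverts G"
    and anchor_in: "u \<in> pverts G"
    and between_old: "\<And>i j. i \<in> pverts G \<Longrightarrow> j \<in> pverts G \<Longrightarrow> between G' i j - {w} = between G i j"
    and between_new: "\<And>i j. i \<in> pverts G \<Longrightarrow> j \<in> pverts G \<Longrightarrow> i \<noteq> u \<Longrightarrow> j \<noteq> u \<Longrightarrow>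
      w \<in> between G' i j \<Longrightarrow> u \<in> between G i j"

lemma node_insertion_single_extension:
  assumes "pair_sym_digraph G" "single_extension G G'"
  obtains w u where "node_insertion G G' w u"
  using assms(2)
proof cases
  case (leaf u w)
  interpret pair_sym_digraph G by fact
  \<comment> \<open>Together with \<open>between_leaf\<close>, this makes \<open>between_new\<close>
    vacuous for a leaf.\<close>
  have "w \<notin> between G i j" if "i \<in> pverts G" for i j
    using leaf that awalkI_apath awalk_verts_in_verts unfolding between_def awalk_def
    by fastforce
  then have "node_insertion G G' w u"
    using leaf between_leaf[OF assms(1) leaf(2,3)] by unfold_locales auto
  then show ?thesis by (rule that)
next
  case (subdivision u v w)
  interpret pair_sym_digraph G by fact
  have "node_insertion G G' w u"
    using subdivision between_subdivide[OF assms(1) subdivision(2,3)]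
      new_node_between_subdivide[OF assms(1) subdivision(2,3)] in_arcsD1
    by unfold_locales auto
  then show ?thesis by (rule that)
qed

section \<open>Vertices and linear maps\<close>

text \<open>Reduces coordinates of nested vectors to entries. The predicate is left open because it
  serves both for integrality and for box bounds.\<close>

lemma ball_Basis_vec:
  fixes x :: "'a::euclidean_space^'n"
  shows "(\<forall>b\<in>Basis. P (x \<bullet> b)) \<longleftrightarrow> (\<forall>i. \<forall>b\<in>Basis. P (x $ i \<bullet> b))"
  unfolding Basis_vec_def by (auto simp: inner_axis)

lemma ball_Basis_prod:
  fixes x :: "'a::euclidean_space \<times> 'b::euclidean_space"
  shows "(\<forall>b\<in>Basis. P (x \<bullet> b)) \<longleftrightarrow>
    (\<forall>b\<in>Basis. P (fst x \<bullet> b)) \<and> (\<forall>b\<in>Basis. P (snd x \<bullet> b))"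
  unfolding Basis_prod_def ball_Un by (simp add: inner_prod_def)

lemmas ball_Basis_simps = ball_Basis_vec ball_Basis_prod

text \<open>A segment with \<open>q\<close> inside maps to a segment around the extreme point
  \<open>M q\<close>, so it collapses and both ends lie in the fibre over \<open>M q\<close>. Each
  \<open>f\<close> in \<open>F\<close> is affine along the segment and minimal at the inner point
  \<open>q\<close>, hence constant there, and \<open>unique\<close> identifies both ends with
  \<open>q\<close>. In applications \<open>F\<close> collects constraints that are tight at
  \<open>q\<close>, or an objective minimised there.\<close>

lemma extreme_point_of_linear_fibre:
  fixes M :: "'a::real_vector \<Rightarrow> 'b::real_vector" and F :: "('a \<Rightarrow> real) set"
  assumes M: "linear M" "M ` S' \<subseteq> S" and q: "q \<in> S'" "M q extreme_point_of S"
    and F: "\<And>f. f \<in> F \<Longrightarrow> linear f"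
    and lower: "\<And>f x. f \<in> F \<Longrightarrow> x \<in> S' \<Longrightarrow> M x = M q \<Longrightarrow> f q \<le> f x"
    and unique: "\<And>x. x \<in> S' \<Longrightarrow> M x = M q \<Longrightarrow> (\<And>f. f \<in> F \<Longrightarrow> f x = f q) \<Longrightarrow> x = q"
  shows "q extreme_point_of S'"
  unfolding extreme_point_of_def
proof (intro conjI ballI notI q(1))
  fix a b assume ab: "a \<in> S'" "b \<in> S'" "q \<in> open_segment a b"
  then obtain t where t: "a \<noteq> b" "0 < t" "t < 1" "q = (1 - t) *\<^sub>R a + t *\<^sub>R b"
    by (auto simp: in_segment)
  have Mq: "M q = (1 - t) *\<^sub>R M a + t *\<^sub>R M b"
    by (simp add: t(4) linear_add[OF M(1)] linear_cmul[OF M(1)])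
  have "M a = M b"
  proof (rule ccontr)
    assume "M a \<noteq> M b"
    then have "M q \<in> open_segment (M a) (M b)"
      using t(2,3) Mq by (auto simp: in_segment)
    then show False
      using q(2) ab M(2) unfolding extreme_point_of_def by blast
  qed
  then have Mab: "M a = M q" "M b = M q"
    using Mq by (simp_all flip: scaleR_left_distrib)
  have fab: "f a = f q \<and> f b = f q" if f: "f \<in> F" for f
  proof -
    have "f q = (1 - t) * f a + t * f b"
      by (simp add: t(4) linear_add[OF F[OF f]] linear_cmul[OF F[OF f]])
    then have eq: "(1 - t) * (f a - f q) + t * (f b - f q) = 0"
      by (simp add: algebra_simps)
    have "0 \<le> (1 - t) * (f a - f q)" "0 \<le> t * (f b - f q)"
      using lower[OF f] ab Mab t by simp_all
    with eq have "(1 - t) * (f a - f q) = 0" "t * (f b - f q) = 0"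
      by linarith+
    then show ?thesis using t by simp
  qed
  have "a = q" "b = q"
    using unique fab ab Mab by blast+
  then show False using t(1) by simp
qed

section \<open>The STT polyhedron\<close>

lemma stt_polyhedronD:
  assumes "(D, X, Z) \<in> stt_polyhedron U"
  shows "i \<notin> pverts U \<Longrightarrow> D $ i = 0"
    and "\<not> (i \<in> pverts U \<and> j \<in> pverts U \<and> i \<noteq> j) \<Longrightarrow> X $ i $ j = 0"
    and "\<not> (i \<in> pverts U \<and> j \<in> pverts U \<and> i \<noteq> j \<and> k \<in> between U i j) \<Longrightarrow> Z $ k $ i $ j = 0"
    and "i \<in> pverts U \<Longrightarrow> j \<in> pverts U \<Longrightarrow> i \<noteq> j \<Longrightarrow> 0 \<le> X $ i $ j"
    and "i \<in> pverts U \<Longrightarrow> j \<in> pverts U \<Longrightarrow> i \<noteq> j \<Longrightarrow>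
      1 \<le> X $ i $ j + X $ j $ i + (\<Sum>k\<in>between U i j. Z $ k $ i $ j)"
    and "i \<in> pverts U \<Longrightarrow> j \<in> pverts U \<Longrightarrow> i \<noteq> j \<Longrightarrow> k \<in> between U i j \<Longrightarrow>
      Z $ k $ i $ j = Z $ k $ j $ i \<and>
      0 \<le> Z $ k $ i $ j \<and> Z $ k $ i $ j \<le> X $ k $ i \<and> Z $ k $ i $ j \<le> X $ k $ j"
    and "i \<in> pverts U \<Longrightarrow> (\<Sum>j\<in>pverts U - {i}. X $ j $ i) \<le> D $ i"
proof -
  note constraints = assms[unfolded stt_polyhedron_def mem_Collect_eq prod.case]
  note zero_D = constraints[THEN conjunct1]
    and zero_X = constraints[THEN conjunct2, THEN conjunct1]
    and zero_Z = constraints[THEN conjunct2, THEN conjunct2, THEN conjunct1]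
    and pair = constraints[THEN conjunct2, THEN conjunct2, THEN conjunct2, THEN conjunct1, rule_format]
    and depth = constraints[THEN conjunct2, THEN conjunct2, THEN conjunct2, THEN conjunct2]
  show "i \<notin> pverts U \<Longrightarrow> D $ i = 0"
    using zero_D by simp
  show "\<not> (i \<in> pverts U \<and> j \<in> pverts U \<and> i \<noteq> j) \<Longrightarrow> X $ i $ j = 0"
    using zero_X by blast
  show "\<not> (i \<in> pverts U \<and> j \<in> pverts U \<and> i \<noteq> j \<and> k \<in> between U i j) \<Longrightarrow> Z $ k $ i $ j = 0"
    using zero_Z by blast
  show "i \<in> pverts U \<Longrightarrow> (\<Sum>j\<in>pverts U - {i}. X $ j $ i) \<le> D $ i"
    using depth by simp
  assume ij: "i \<in> pverts U" "j \<in> pverts U" "i \<noteq> j"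
  show "0 \<le> X $ i $ j"
    using pair[OF ij] by blast
  show "1 \<le> X $ i $ j + X $ j $ i + (\<Sum>k\<in>between U i j. Z $ k $ i $ j)"
    using pair[OF ij] by blast
  show "k \<in> between U i j \<Longrightarrow> Z $ k $ i $ j = Z $ k $ j $ i \<and>
      0 \<le> Z $ k $ i $ j \<and> Z $ k $ i $ j \<le> X $ k $ i \<and> Z $ k $ i $ j \<le> X $ k $ j"
    using pair[OF ij] by blast
qed

text \<open>Signs, symmetry and the bounds on \<open>Z\<close> are requested for all indices: they
  also hold at the zero padding, and this saves case distinctions on membership.\<close>

lemma stt_polyhedronI:
  assumes zero_D: "\<And>i. i \<notin> pverts U \<Longrightarrow> D $ i = 0"
    and zero_X: "\<And>i j. \<not> (i \<in> pverts U \<and> j \<in> pverts U \<and> i \<noteq> j) \<Longrightarrow> X $ i $ j = 0"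
    and zero_Z: "\<And>k i j. \<not> (i \<in> pverts U \<and> j \<in> pverts U \<and> i \<noteq> j \<and> k \<in> between U i j) \<Longrightarrow>
      Z $ k $ i $ j = 0"
    and pair: "\<And>i j. 0 \<le> X $ i $ j"
      "\<And>i j. i \<in> pverts U \<Longrightarrow> j \<in> pverts U \<Longrightarrow> i \<noteq> j \<Longrightarrow>
        1 \<le> X $ i $ j + X $ j $ i + (\<Sum>k\<in>between U i j. Z $ k $ i $ j)"
      "\<And>k i j. Z $ k $ i $ j = Z $ k $ j $ i" "\<And>k i j. 0 \<le> Z $ k $ i $ j"
      "\<And>k i j. Z $ k $ i $ j \<le> X $ k $ i" "\<And>k i j. Z $ k $ i $ j \<le> X $ k $ j"
    and depth: "\<And>i. i \<in> pverts U \<Longrightarrow> (\<Sum>j\<in>pverts U - {i}. X $ j $ i) \<le> D $ i"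
  shows "(D, X, Z) \<in> stt_polyhedron U"
  unfolding stt_polyhedron_def mem_Collect_eq prod.case
  by (intro conjI allI ballI impI zero_D zero_X zero_Z pair depth)

lemma closed_stt_polyhedron: "closed (stt_polyhedron U)"
  unfolding stt_polyhedron_def case_prod_beta Ball_def
  by (intro closed_Collect_conj closed_Collect_all closed_Collect_imp closed_Collect_le
      closed_Collect_eq open_Collect_const) (rule continuous_intros)+

text \<open>The padding extends the sign constraints to all indices. Since column \<open>j\<close>
  of \<open>X\<close> is nonnegative with sum at most \<open>D $ j\<close>, the depths bound every
  \<open>X\<close>, and through it every \<open>Z\<close>.\<close>

lemma stt_polyhedron_bounds:
  assumes mem: "(D, X, Z) \<in> stt_polyhedron U"
  shows "0 \<le> X $ i $ j" "X $ i $ j \<le> D $ j" "0 \<le> D $ i"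
    "0 \<le> Z $ k $ i $ j" "Z $ k $ i $ j \<le> X $ k $ i" "Z $ k $ i $ j \<le> X $ k $ j"
proof -
  note con = stt_polyhedronD[OF mem]
  show X0: "0 \<le> X $ i $ j" for i j
    using con(2,4)[of i j] by fastforce
  show D0: "0 \<le> D $ i" for i
  proof (cases "i \<in> pverts U")
    case True
    have "0 \<le> (\<Sum>j\<in>pverts U - {i}. X $ j $ i)" by (intro sum_nonneg X0)
    with con(7)[OF True] show ?thesis by simp
  qed (use con(1) in simp)
  show "X $ i $ j \<le> D $ j"
  proof (cases "i \<in> pverts U \<and> j \<in> pverts U \<and> i \<noteq> j")
    case True
    then have "X $ i $ j \<le> (\<Sum>i\<in>pverts U - {j}. X $ i $ j)"
      by (intro member_le_sum X0) auto
    with con(7)[of j] True show ?thesis by simp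
  next
    case False
    then show ?thesis using con(2) D0 by simp
  qed
  have "0 \<le> Z $ k $ i $ j \<and> Z $ k $ i $ j \<le> X $ k $ i \<and> Z $ k $ i $ j \<le> X $ k $ j"
  proof (cases "i \<in> pverts U \<and> j \<in> pverts U \<and> i \<noteq> j \<and> k \<in> between U i j")
    case True
    then show ?thesis using con(6) by blast
  next
    case False
    then show ?thesis using con(3)[OF False] X0 by simp
  qed
  then show "0 \<le> Z $ k $ i $ j" "Z $ k $ i $ j \<le> X $ k $ i" "Z $ k $ i $ j \<le> X $ k $ j"
    by simp_all
qed

lemma stt_polyhedron_zero:
  assumes mem: "(D, X, Z) \<in> stt_polyhedron U"
  shows "i \<notin> pverts U \<Longrightarrow> D $ i = 0"
    "i \<notin> pverts U \<Longrightarrow> X $ i $ j = 0" "j \<notin> pverts U \<Longrightarrow> X $ i $ j = 0" "X $ i $ i = 0"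
    "i \<notin> pverts U \<Longrightarrow> Z $ k $ i $ j = 0" "j \<notin> pverts U \<Longrightarrow> Z $ k $ i $ j = 0"
    "Z $ k $ i $ i = 0" "k \<notin> between U i j \<Longrightarrow> Z $ k $ i $ j = 0"
  by (simp_all add: stt_polyhedronD[OF mem])

text \<open>If \<open>k\<close> is in \<open>between U i j\<close> or in
  \<open>between U j i\<close>, that membership gives the equation; otherwise both sides are
  0.\<close>

lemma stt_polyhedron_sym:
  assumes mem: "(D, X, Z) \<in> stt_polyhedron U"
  shows "Z $ k $ i $ j = Z $ k $ j $ i"
  using stt_polyhedronD(3)[OF mem, of i j k] stt_polyhedronD(3)[OF mem, of j i k]
    stt_polyhedronD(6)[OF mem, of i j k] stt_polyhedronD(6)[OF mem, of j i k]
  by metis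

text \<open>An upper bound on the depths confines all coordinates to a box, by the chain from 0
  through \<open>Z\<close>, \<open>X\<close> and \<open>D\<close> to \<open>B\<close>.\<close>

lemma compact_stt_polyhedron_bounded_depth:
  fixes B :: "real^'v::finite"
  shows "compact {p \<in> stt_polyhedron U. \<forall>i. fst p $ i \<le> B $ i}" (is "compact ?K")
proof -
  \<comment> \<open>A single bound above every \<open>B $ i\<close>, so that the box can be a
    cube.\<close>
  define b where "b = (\<Sum>i\<in>UNIV. \<bar>B $ i\<bar>)"
  have b: "B $ i \<le> b" for i
    using member_le_sum[of i UNIV "\<lambda>i. \<bar>B $ i\<bar>"] unfolding b_def by force
  have "?K \<subseteq> cbox 0 (b *\<^sub>R One)"
  proof
    fix p assume p: "p \<in> ?K"
    obtain D X Z where DXZ: "p = (D, X, Z)" by (cases p)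
    then have mem: "(D, X, Z) \<in> stt_polyhedron U" and DB: "\<And>i. D $ i \<le> B $ i"
      using p by auto
    note bnds = stt_polyhedron_bounds[OF mem]
    have "D $ i \<le> b" "X $ i $ j \<le> b" "Z $ k $ i $ j \<le> b" for i j k
      using DB[of i] DB[of j] b[of i] b[of j] bnds(2)[of i j] bnds(6)[of k i j] bnds(2)[of k j]
      by linarith+
    then have "\<forall>c\<in>Basis. 0 \<le> p \<bullet> c \<and> p \<bullet> c \<le> b"
      using bnds DXZ unfolding ball_Basis_simps[where P = "\<lambda>y. 0 \<le> y \<and> y \<le> b"] by simp
    then show "p \<in> cbox 0 (b *\<^sub>R One)"
      by (auto simp: mem_box)
  qed
  then have "bounded ?K" using bounded_cbox bounded_subset by blast
  moreover have "closed ?K"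
  proof -
    have "closed {p. \<forall>i. fst p $ i \<le> B $ i}"
      by (intro closed_Collect_all closed_Collect_le continuous_intros)
    then have "closed (stt_polyhedron U \<inter> {p. \<forall>i. fst p $ i \<le> B $ i})"
      using closed_stt_polyhedron by (intro closed_Int)
    then show ?thesis by (simp add: Int_def)
  qed
  ultimately show ?thesis by (simp add: compact_eq_bounded_closed)
qed

section \<open>Inserting one node\<close>

type_synonym 'v stt_point = "(real^'v) \<times> (real^'v^'v) \<times> (real^'v^'v^'v)"

context node_insertion
begin

section \<open>Merging the new node into its anchor\<close>

text \<open>Entries that would land on a padded position, such as \<open>X $ w $ u\<close> on the
  diagonal or \<open>Z $ w $ i $ j\<close> with \<open>u\<close> as an end, are dropped.\<close>

definition merge :: "'v stt_point \<Rightarrow> 'v stt_point" where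
  "merge = (\<lambda>(D, X, Z).
    (\<chi> i. if i = w then 0 else D $ i,
     \<chi> i j. if i = w \<or> j = w then 0 else if i = u \<and> j \<noteq> u then X $ u $ j + X $ w $ j else X $ i $ j,
     \<chi> k i j. if k = w \<or> i = w \<or> j = w then 0
       else if k = u \<and> i \<noteq> u \<and> j \<noteq> u then Z $ u $ i $ j + Z $ w $ i $ j else Z $ k $ i $ j))"

lemma linear_merge: "linear merge"
  by (rule linearI) (auto simp: merge_def vec_eq_iff algebra_simps)

text \<open>The critical constraint is the cover of a pair \<open>i\<close>, \<open>j\<close>, whose
  sum loses \<open>Z $ w $ i $ j\<close>. If \<open>u\<close> is not an end, this value reappears in
  the entry of \<open>u\<close>; if it is, the added row of \<open>w\<close> compensates. Depths
  suffice because \<open>X $ w $ i\<close> was already counted in the depth of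
  \<open>i\<close>.\<close>

lemma merge_mem:
  assumes mem: "p \<in> stt_polyhedron G'"
  shows "merge p \<in> stt_polyhedron G"
proof -
  obtain D X Z where p: "p = (D, X, Z)" by (cases p)
  have mem: "(D, X, Z) \<in> stt_polyhedron G'" using mem p by simp
  note bnds = stt_polyhedron_bounds[OF mem]
  note zeros = stt_polyhedron_zero[OF mem]
  note symm = stt_polyhedron_sym[OF mem]
  obtain D' X' Z' where m: "merge p = (D', X', Z')" by (cases "merge p")
  have D': "D' $ i = (if i = w then 0 else D $ i)" for i
    using m by (auto simp: merge_def p)
  have X': "X' $ i $ j = (if i = w \<or> j = w then 0
      else if i = u \<and> j \<noteq> u then X $ u $ j + X $ w $ j else X $ i $ j)" for i j
    using m by (auto simp: merge_def p)
  have Z': "Z' $ k $ i $ j = (if k = w \<or> i = w \<or> j = w then 0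
      else if k = u \<and> i \<noteq> u \<and> j \<noteq> u then Z $ u $ i $ j + Z $ w $ i $ j else Z $ k $ i $ j)" for k i j
    using m by (auto simp: merge_def p)
  have uw: "u \<noteq> w" using anchor_in new_notin by auto
  have notw: "i \<noteq> w" if "i \<in> pverts G" for i using that new_notin by auto
  have notin: "i \<notin> pverts G'" if "i \<notin> pverts G" "i \<noteq> w" for i
    using that verts by auto
  have bw: "w \<notin> between G i j" if "i \<in> pverts G" "j \<in> pverts G" for i j
    using between_old[OF that] by blast
  have sum_between: "(\<Sum>k\<in>between G' i j. Z $ k $ i $ j) = (\<Sum>k\<in>between G i j. Z $ k $ i $ j) + Z $ w $ i $ j"
    if "i \<in> pverts G" "j \<in> pverts G" for i j
  proof (cases "w \<in> between G' i j")
    case True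
    then show ?thesis using between_old[OF that]
      by (simp add: sum.remove[of _ w])
  next
    case False
    then have "between G' i j = between G i j" using between_old[OF that] by auto
    then show ?thesis using zeros(8)[OF False] by simp
  qed
  have "(D', X', Z') \<in> stt_polyhedron G"
  proof (rule stt_polyhedronI)
    show "D' $ i = 0" if "i \<notin> pverts G" for i
      using zeros(1) notin[OF that] by (auto simp: D')
    show "X' $ i $ j = 0" if "\<not> (i \<in> pverts G \<and> j \<in> pverts G \<and> i \<noteq> j)" for i j
      using that zeros(2-4) notin anchor_in by (auto simp: X')
    show "Z' $ k $ i $ j = 0"
      if "\<not> (i \<in> pverts G \<and> j \<in> pverts G \<and> i \<noteq> j \<and> k \<in> between G i j)" for i j k
    proof (cases "i \<in> pverts G \<and> j \<in> pverts G \<and> i \<noteq> j")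
      case False
      then show ?thesis using zeros(5-7) notin by (auto simp: Z')
    next
      case True
      then have k: "k \<notin> between G i j" using that by simp
      then have "k = w \<or> Z $ k $ i $ j = 0"
        using zeros(8) between_old True by blast
      \<comment> \<open>Contrapositive of \<open>between_new\<close>: where \<open>u\<close> is not
        between, neither is \<open>w\<close>.\<close>
      moreover have "Z $ w $ i $ j = 0" if "k = u" "i \<noteq> u" "j \<noteq> u"
        using zeros(8) between_new True that k by blast
      ultimately show ?thesis by (auto simp: Z')
    qed
    show "0 \<le> X' $ i $ j" for i j
      using bnds(1) by (simp add: X')
    show "1 \<le> X' $ i $ j + X' $ j $ i + (\<Sum>k\<in>between G i j. Z' $ k $ i $ j)"
      if ij: "i \<in> pverts G" "j \<in> pverts G" "i \<noteq> j" for i j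
    proof -
      have cover: "1 \<le> X $ i $ j + X $ j $ i + (\<Sum>k\<in>between G i j. Z $ k $ i $ j) + Z $ w $ i $ j"
        using stt_polyhedronD(5)[OF mem, of i j] ij verts sum_between[OF ij(1,2)] by simp
      show ?thesis
      proof (cases "i = u \<or> j = u")
        \<comment> \<open>Here \<open>Z $ w $ i $ j\<close> is at most \<open>X $ w\<close> at the
          end other than \<open>u\<close>, a term which merging adds to row
          \<open>u\<close>.\<close>
        case True
        have "(\<Sum>k\<in>between G i j. Z' $ k $ i $ j) = (\<Sum>k\<in>between G i j. Z $ k $ i $ j)"
          using True bw ij notw by (intro sum.cong) (auto simp: Z')
        moreover have "X $ i $ j + X $ j $ i + Z $ w $ i $ j \<le> X' $ i $ j + X' $ j $ i"
          using True ij notw uw bnds(5)[of w i j] bnds(6)[of w i j] by (auto simp: X')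
        ultimately show ?thesis using cover by linarith
      next
        case False
        have "(\<Sum>k\<in>between G i j. Z' $ k $ i $ j)
            = (\<Sum>k\<in>between G i j. Z $ k $ i $ j + (if k = u then Z $ w $ i $ j else 0))"
          using False bw ij notw by (intro sum.cong) (auto simp: Z')
        also have "\<dots> = (\<Sum>k\<in>between G i j. Z $ k $ i $ j) + (if u \<in> between G i j then Z $ w $ i $ j else 0)"
          by (simp add: sum.distrib sum.delta)
        \<comment> \<open>If \<open>u\<close> is not between the ends, then neither is
          \<open>w\<close>, and its entry is 0.\<close>
        also have "\<dots> = (\<Sum>k\<in>between G i j. Z $ k $ i $ j) + Z $ w $ i $ j"
          using between_new[of i j] zeros(8)[of w i j] False ij by auto
        finally show ?thesis using cover False ij notw by (simp add: X')
      qed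
    qed
    show "Z' $ k $ i $ j = Z' $ k $ j $ i" for i j k
      using symm by (auto simp: Z')
    show "0 \<le> Z' $ k $ i $ j" for i j k
      using bnds(4) by (simp add: Z')
    \<comment> \<open>The \<open>add_increasing2\<close> fact is for \<open>k = u\<close> and
      \<open>j = u\<close>, where \<open>X\<close> received the summand of \<open>w\<close> but
      \<open>Z\<close> did not.\<close>
    show "Z' $ k $ i $ j \<le> X' $ k $ i" for i j k
      using bnds(1,5) add_mono[OF bnds(5)[of u i j] bnds(5)[of w i j]] bnds(5)[of k i j]
        add_increasing2[OF bnds(1)[of w i] bnds(5)[of u i j]]
      by (auto simp: X' Z')
    show "Z' $ k $ i $ j \<le> X' $ k $ j" for i j k
      using bnds(1,6) add_mono[OF bnds(6)[of u i j] bnds(6)[of w i j]] bnds(6)[of k i j]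
        add_increasing2[OF bnds(1)[of w j] bnds(6)[of u i j]]
      by (auto simp: X' Z')
    show "(\<Sum>j\<in>pverts G - {i}. X' $ j $ i) \<le> D' $ i" if i: "i \<in> pverts G" for i
    proof -
      have "(\<Sum>j\<in>pverts G - {i}. X' $ j $ i)
          \<le> (\<Sum>j\<in>pverts G - {i}. X $ j $ i + (if j = u then X $ w $ i else 0))"
        using i notw bnds(1) by (intro sum_mono) (auto simp: X')
      \<comment> \<open>Only for \<open>i = u\<close> can this be strict, the dropped entry being
        \<open>X $ w $ u\<close>.\<close>
      also have "\<dots> \<le> (\<Sum>j\<in>pverts G - {i}. X $ j $ i) + X $ w $ i"
        using bnds(1) by (simp add: sum.distrib sum.delta)
      also have "\<dots> = (\<Sum>j\<in>pverts G' - {i}. X $ j $ i)"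
      proof -
        have "pverts G' - {i} = insert w (pverts G - {i})" using verts i notw by auto
        then show ?thesis using new_notin by simp
      qed
      also have "\<dots> \<le> D $ i"
        using stt_polyhedronD(7)[OF mem, of i] i verts by simp
      finally show ?thesis using i notw by (simp add: D')
    qed
  qed
  then show ?thesis by (simp add: m)
qed

section \<open>Lifting a point by a deepest node\<close>

lemma zero_at_new_node:
  assumes mem: "(D, X, Z) \<in> stt_polyhedron G"
  shows "Z $ k $ w $ j = 0" "Z $ k $ i $ w = 0" "Z $ w $ i $ j = 0"
proof -
  note zeros = stt_polyhedron_zero[OF mem]
  show "Z $ k $ w $ j = 0" "Z $ k $ i $ w = 0"
    using zeros(5,6) new_notin by simp_all
  show "Z $ w $ i $ j = 0"
  proof (cases "i \<in> pverts G \<and> j \<in> pverts G")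
    case True
    then have "w \<notin> between G i j" using between_old[of i j] by blast
    then show ?thesis by (rule zeros(8))
  next
    case False
    then show ?thesis using zeros(5,6) by auto
  qed
qed

text \<open>With \<open>X $ i $ j\<close> read as "\<open>i\<close> is an ancestor of
  \<open>j\<close>", every old node becomes an ancestor of \<open>w\<close>. Row \<open>w\<close>
  and all \<open>Z\<close> entries of \<open>w\<close> stay at the padding value 0, and
  \<open>D $ w\<close> is exactly the sum of column \<open>w\<close>, which makes its depth
  constraint tight.\<close>

definition append_below :: "'v stt_point \<Rightarrow> 'v stt_point" where
  "append_below = (\<lambda>(D, X, Z).
    (\<chi> i. if i = w then of_nat (card (pverts G)) else D $ i,
     \<chi> i j. if j = w \<and> i \<in> pverts G then 1 else X $ i $ j,
     Z))"

text \<open>A pair containing \<open>w\<close> is covered by its entry 1 in column \<open>w\<close>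
  alone. Old pairs keep their cover, as a possible new summand for \<open>w\<close> is 0, and old
  depths gain nothing from the zero row of \<open>w\<close>.\<close>

lemma append_below_mem:
  assumes mem: "p \<in> stt_polyhedron G"
  shows "append_below p \<in> stt_polyhedron G'"
proof -
  obtain D X Z where p: "p = (D, X, Z)" by (cases p)
  have mem: "(D, X, Z) \<in> stt_polyhedron G" using mem p by simp
  note bnds = stt_polyhedron_bounds[OF mem]
  note zeros = stt_polyhedron_zero[OF mem]
  obtain D' X' where m: "append_below p = (D', X', Z)"
    by (auto simp: append_below_def p)
  have D': "D' $ i = (if i = w then of_nat (card (pverts G)) else D $ i)" for i
    using m by (auto simp: append_below_def p)
  have X': "X' $ i $ j = (if j = w \<and> i \<in> pverts G then 1 else X $ i $ j)" for i j
    using m by (auto simp: append_below_def p)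
  have notw: "i \<noteq> w" if "i \<in> pverts G" for i using that new_notin by auto
  note Zw = zero_at_new_node[OF mem]
  have "(D', X', Z) \<in> stt_polyhedron G'"
  proof (rule stt_polyhedronI)
    show "D' $ i = 0" if "i \<notin> pverts G'" for i
      using zeros(1) that verts by (auto simp: D')
    show "X' $ i $ j = 0" if "\<not> (i \<in> pverts G' \<and> j \<in> pverts G' \<and> i \<noteq> j)" for i j
      using that zeros(2-4) verts new_notin by (auto simp: X')
    show "Z $ k $ i $ j = 0"
      if "\<not> (i \<in> pverts G' \<and> j \<in> pverts G' \<and> i \<noteq> j \<and> k \<in> between G' i j)" for i j k
    proof (cases "i \<in> pverts G \<and> j \<in> pverts G \<and> i \<noteq> j \<and> k \<in> between G i j")
      case True
      then have "k \<in> between G' i j" using between_old[of i j] by blast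
      then show ?thesis using that True verts by auto
    next
      case False
      then show ?thesis by (rule stt_polyhedronD(3)[OF mem])
    qed
    show "0 \<le> X' $ i $ j" for i j
      using bnds(1) by (simp add: X')
    show "1 \<le> X' $ i $ j + X' $ j $ i + (\<Sum>k\<in>between G' i j. Z $ k $ i $ j)"
      if ij: "i \<in> pverts G'" "j \<in> pverts G'" "i \<noteq> j" for i j
    proof (cases "i = w \<or> j = w")
      case True
      then have "1 \<le> X' $ i $ j + X' $ j $ i" using ij verts bnds(1) by (auto simp: X')
      moreover have "0 \<le> (\<Sum>k\<in>between G' i j. Z $ k $ i $ j)" by (intro sum_nonneg bnds(4))
      ultimately show ?thesis by linarith
    next
      case False
      then have ij': "i \<in> pverts G" "j \<in> pverts G" using ij verts by auto
      have "(\<Sum>k\<in>between G' i j. Z $ k $ i $ j) = (\<Sum>k\<in>between G i j. Z $ k $ i $ j)"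
        using between_old[OF ij'] Zw by (intro sum.mono_neutral_right) auto
      then show ?thesis
        using stt_polyhedronD(5)[OF mem ij' ij(3)] False by (simp add: X')
    qed
    show "Z $ k $ i $ j = Z $ k $ j $ i" for i j k
      using stt_polyhedron_sym[OF mem] .
    show "0 \<le> Z $ k $ i $ j" for i j k
      using bnds(4) .
    show "Z $ k $ i $ j \<le> X' $ k $ i" "Z $ k $ i $ j \<le> X' $ k $ j" for i j k
      using bnds(5,6)[of k i j] Zw by (auto simp: X')
    show "(\<Sum>j\<in>pverts G' - {i}. X' $ j $ i) \<le> D' $ i" if i: "i \<in> pverts G'" for i
    proof (cases "i = w")
      case True
      then have "pverts G' - {i} = pverts G" using verts new_notin by auto
      then show ?thesis using True by (simp add: X' D')
    next
      case False
      then have "pverts G' - {i} = insert w (pverts G - {i})" "i \<in> pverts G" using verts i by auto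
      then show ?thesis
        using stt_polyhedronD(7)[OF mem, of i] False new_notin zeros(2)[of w]
        by (simp add: X' D')
    qed
  qed
  then show ?thesis by (simp add: m)
qed

text \<open>Everything that merging adds to the entries of \<open>u\<close> is zero in the lift, so
  the lift lies in the fibre over \<open>p\<close>.\<close>

lemma merge_append_below:
  assumes mem: "p \<in> stt_polyhedron G"
  shows "merge (append_below p) = p"
proof -
  obtain D X Z where p: "p = (D, X, Z)" by (cases p)
  have mem: "(D, X, Z) \<in> stt_polyhedron G" using mem p by simp
  note zeros = stt_polyhedron_zero[OF mem]
  have "X $ w $ j = 0" "X $ i $ w = 0" "D $ w = 0" for i j
    using zeros(1-3) new_notin by simp_all
  then show ?thesis
    using zero_at_new_node[OF mem] new_notin
    by (auto simp: p merge_def append_below_def vec_eq_iff)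
qed

section \<open>Vertices of the polyhedron\<close>

lemma extreme_append_below:
  assumes "p extreme_point_of stt_polyhedron G"
  shows "append_below p extreme_point_of stt_polyhedron G'"
proof -
  have p: "p \<in> stt_polyhedron G" using assms by (simp add: extreme_point_of_def)
  obtain D X Z where DXZ: "p = (D, X, Z)" by (cases p)
  have mem: "(D, X, Z) \<in> stt_polyhedron G" using p DXZ by simp
  have Xw: "X $ w $ j = 0" for j using stt_polyhedron_zero(2)[OF mem] new_notin by simp
  note Zw = zero_at_new_node[OF mem]
  note q = append_below_mem[OF p]
  have q_eq: "append_below p = (\<chi> i. if i = w then of_nat (card (pverts G)) else D $ i,
      \<chi> i j. if j = w \<and> i \<in> pverts G then 1 else X $ i $ j, Z)"
    by (simp add: append_below_def DXZ)
  define row where "row j p = fst (snd p) $ w $ j"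
    for j and p :: "'v stt_point"
  define triple where "triple t p = (case t of (k, i, j) \<Rightarrow> snd (snd p) $ k $ i $ j)"
    for t and p :: "'v stt_point"
  define cover where "cover i p = fst (snd p) $ i $ w + fst (snd p) $ w $ i
      + (\<Sum>k\<in>between G' i w. snd (snd p) $ k $ i $ w)"
    for i and p :: "'v stt_point"
  define slack where "slack p = fst p $ w - (\<Sum>j\<in>pverts G. fst (snd p) $ j $ w)"
    for p :: "'v stt_point"
  define T where "T = {(k, i, j). k = w \<or> i = w \<or> j = w}"
  \<comment> \<open>Constraints tight at the lift: nonnegativity of row \<open>w\<close> and of all
    \<open>Z\<close> entries mentioning \<open>w\<close>, the covers of the pairs with
    \<open>w\<close>, and the depth of \<open>w\<close>.\<close>
  define F where "F = range row \<union> triple ` T \<union> cover ` pverts G \<union> {slack}"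
  have lin: "linear (row j)" "linear (triple t)" "linear (cover i)" "linear slack" for i j t
    by (rule linearI; simp add: row_def triple_def cover_def slack_def case_prod_beta
        sum.distrib sum_distrib_left algebra_simps)+
  have qv: "row j (append_below p) = 0" "cover i (append_below p) = (if i \<in> pverts G then 1 else X $ i $ w)"
    "slack (append_below p) = 0" for i j
    using new_notin Xw Zw by (simp_all add: row_def cover_def slack_def q_eq)
  have qt: "triple t (append_below p) = 0" if "t \<in> T" for t
    using that Zw by (auto simp: triple_def T_def q_eq)
  show ?thesis
  proof (rule extreme_point_of_linear_fibre[where M = merge and S = "stt_polyhedron G" and F = F])
    show "linear merge" by (rule linear_merge)
    show "merge ` stt_polyhedron G' \<subseteq> stt_polyhedron G" using merge_mem by blast
    show "append_below p \<in> stt_polyhedron G'" by (rule q)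
    show "merge (append_below p) extreme_point_of stt_polyhedron G"
      using assms merge_append_below[OF p] by simp
    show "linear f" if "f \<in> F" for f
      using that lin unfolding F_def by blast
  next
    fix f x assume f: "f \<in> F" and x: "x \<in> stt_polyhedron G'"
    obtain D' X' Z' where x_eq: "x = (D', X', Z')" by (cases x)
    have mem': "(D', X', Z') \<in> stt_polyhedron G'" using x x_eq by simp
    note bnds = stt_polyhedron_bounds[OF mem']
    from f consider j where "f = row j" | t where "t \<in> T" "f = triple t"
      | i where "i \<in> pverts G" "f = cover i" | "f = slack"
      unfolding F_def by blast
    then show "f (append_below p) \<le> f x"
    proof cases
      case (1 j)
      then show ?thesis using bnds(1) qv(1) by (simp add: row_def x_eq)
    next
      case (2 t)
      then show ?thesis using bnds(4) qt by (simp add: triple_def x_eq case_prod_beta)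
    next
      case (3 i)
      then have "1 \<le> cover i x"
        using stt_polyhedronD(5)[OF mem', of i w] verts new_notin
        by (auto simp: cover_def x_eq)
      then show ?thesis using 3 qv(2) by simp
    next
      case 4
      have "pverts G' - {w} = pverts G" using verts new_notin by auto
      then have "0 \<le> slack x"
        using stt_polyhedronD(7)[OF mem', of w] verts by (simp add: slack_def x_eq)
      then show ?thesis using 4 qv(3) by simp
    qed
  next
    fix x assume x: "x \<in> stt_polyhedron G'" and mx: "merge x = merge (append_below p)"
      and fx: "\<And>f. f \<in> F \<Longrightarrow> f x = f (append_below p)"
    obtain D' X' Z' where x_eq: "x = (D', X', Z')" by (cases x)
    have mem': "(D', X', Z') \<in> stt_polyhedron G'" using x x_eq by simp
    note zeros = stt_polyhedron_zero[OF mem']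
    have row: "X' $ w $ j = 0" for j
      using fx[of "row j"] qv(1) by (simp add: F_def row_def x_eq)
    have triple: "Z' $ k $ i $ j = 0" if "k = w \<or> i = w \<or> j = w" for k i j
    proof -
      have "(k, i, j) \<in> T" using that by (simp add: T_def)
      then have "triple (k, i, j) x = 0" using fx[of "triple (k, i, j)"] qt by (simp add: F_def)
      then show ?thesis by (simp add: triple_def x_eq)
    qed
    \<comment> \<open>With row \<open>w\<close> and the \<open>Z\<close> entries gone, the tight
      cover leaves only \<open>X' $ i $ w\<close>; the tight depth constraint then fixes
      \<open>D' $ w\<close>.\<close>
    have col: "X' $ i $ w = 1" if "i \<in> pverts G" for i
    proof -
      have "cover i x = 1" using fx[of "cover i"] qv(2) that by (simp add: F_def)
      then show ?thesis by (simp add: cover_def x_eq row triple)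
    qed
    have "D' $ w = of_nat (card (pverts G))"
      using fx[of slack] qv(3) col by (simp add: F_def slack_def x_eq)
    moreover have m: "merge (D', X', Z') = (D, X, Z)"
      using mx merge_append_below[OF p] by (simp add: x_eq DXZ)
    have "D' $ i = D $ i" if "i \<noteq> w" for i
      using m that by (auto simp: merge_def)
    moreover have "X' $ i $ j = (if j = w \<and> i \<in> pverts G then 1 else X $ i $ j)" for i j
    proof -
      consider "i = w" | "i \<noteq> w" "j \<noteq> w" | "i \<noteq> w" "j = w" "i \<notin> pverts G" | "j = w" "i \<in> pverts G"
        by blast
      then show ?thesis
      proof cases
        case 1
        then show ?thesis using row Xw new_notin by simp
      next
        case 2
        \<comment> \<open>In row \<open>u\<close>, merging yields
          \<open>X' $ u $ j + X' $ w $ j\<close>, whose second summand vanishes.\<close>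
        then show ?thesis using m row by (auto simp: merge_def)
      next
        case 3
        then show ?thesis
          using zeros(2)[of i w] verts stt_polyhedron_zero(2)[OF mem] by simp
      next
        case 4
        then show ?thesis using col by simp
      qed
    qed
    moreover have "Z' $ k $ i $ j = Z $ k $ i $ j" for k i j
      using m triple Zw by (cases "k = w \<or> i = w \<or> j = w") (auto simp: merge_def)
    ultimately show "x = append_below p"
      by (simp add: x_eq q_eq vec_eq_iff)
  qed
qed

text \<open>The lift changes only coordinates that are 0 in \<open>p\<close>, so a non-integer one
  survives.\<close>

lemma has_noninteger_vertex_stt_polyhedron:
  assumes "has_noninteger_vertex (stt_polyhedron G)"
  shows "has_noninteger_vertex (stt_polyhedron G')"
proof -
  obtain p where p: "p extreme_point_of stt_polyhedron G" "\<not> (\<forall>b\<in>Basis. p \<bullet> b \<in> \<int>)"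
    using assms unfolding has_noninteger_vertex_def by blast
  obtain D X Z where DXZ: "p = (D, X, Z)" by (cases p)
  have mem: "(D, X, Z) \<in> stt_polyhedron G"
    using p(1) DXZ by (simp add: extreme_point_of_def)
  note zeros = stt_polyhedron_zero[OF mem]
  have "\<not> (\<forall>b\<in>Basis. append_below p \<bullet> b \<in> \<int>)"
  proof
    assume "\<forall>b\<in>Basis. append_below p \<bullet> b \<in> \<int>"
    then have int: "\<And>i. (if i = w then of_nat (card (pverts G)) else D $ i) \<in> \<int>"
      "\<And>i j. (if j = w \<and> i \<in> pverts G then 1 else X $ i $ j) \<in> \<int>" "\<And>k i j. Z $ k $ i $ j \<in> \<int>"
      unfolding ball_Basis_simps[where P = "\<lambda>y. y \<in> \<int>"]
      by (simp_all add: append_below_def DXZ)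
    have "D $ i \<in> \<int>" for i
      using int(1)[of i] zeros(1)[of i] new_notin by (cases "i = w") auto
    moreover have "X $ i $ j \<in> \<int>" for i j
      using int(2)[of j i] zeros(3)[of j i] new_notin by (cases "j = w") auto
    ultimately show False
      using p(2) int(3) unfolding ball_Basis_simps[where P = "\<lambda>y. y \<in> \<int>"] DXZ by simp
  qed
  then show ?thesis
    using extreme_append_below[OF p(1)] unfolding has_noninteger_vertex_def by blast
qed

section \<open>Vertices of the depth projection\<close>

definition forget :: "real^'v \<Rightarrow> real^'v" where
  "forget D = (\<chi> i. if i = w then 0 else D $ i)"

lemma forget_depth_projection: "forget ` depth_projection G' \<subseteq> depth_projection G"
proof (rule image_subsetI)
  fix D assume "D \<in> depth_projection G'"
  then obtain p where p: "p \<in> stt_polyhedron G'" "D = fst p"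
    unfolding depth_projection_def by blast
  then have "forget D = fst (merge p)"
    by (simp add: merge_def forget_def case_prod_beta)
  then show "forget D \<in> depth_projection G"
    unfolding depth_projection_def using imageI[OF merge_mem[OF p(1)]] by simp
qed

text \<open>In the fibre of \<open>forget\<close> over \<open>d\<close> only the depth of
  \<open>w\<close> varies, so a point minimising it is a vertex. The lift shows that the fibre is
  nonempty and supplies a cutoff for the minimisation.\<close>

lemma has_noninteger_vertex_depth_projection:
  assumes "has_noninteger_vertex (depth_projection G)"
  shows "has_noninteger_vertex (depth_projection G')"
proof -
  obtain d where d: "d extreme_point_of depth_projection G" "\<not> (\<forall>b\<in>Basis. d \<bullet> b \<in> \<int>)"
    using assms unfolding has_noninteger_vertex_def by blast
  then obtain p0 where p0: "p0 \<in> stt_polyhedron G" "fst p0 = d"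
    unfolding depth_projection_def extreme_point_of_def by blast
  have dw: "d $ w = 0"
    using p0 stt_polyhedron_zero(1) new_notin by (cases p0) auto
  define D0 where "D0 = fst (append_below p0)"
  have D0: "D0 $ i = d $ i" if "i \<noteq> w" for i
    using that p0(2) by (auto simp: D0_def append_below_def case_prod_beta)
  have forget_iff: "forget D = d \<longleftrightarrow> (\<forall>i. i \<noteq> w \<longrightarrow> D $ i = d $ i)" for D
    using dw by (auto simp: forget_def vec_eq_iff)
  \<comment> \<open>The minimum is sought among full points \<open>(D, X, Z)\<close>, where
    compactness is available. The bound \<open>D0\<close> agrees with \<open>d\<close> off
    \<open>w\<close>, so on the fibre it restricts only the depth of \<open>w\<close>.\<close>
  define K where "K = {p \<in> stt_polyhedron G'. \<forall>i. fst p $ i \<le> D0 $ i}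
    \<inter> {p. \<forall>i. i \<noteq> w \<longrightarrow> fst p $ i = d $ i}"
  have "closed {p :: 'v stt_point. \<forall>i. i \<noteq> w \<longrightarrow> fst p $ i = d $ i}"
    by (intro closed_Collect_all closed_Collect_imp closed_Collect_eq open_Collect_const)
      (rule continuous_intros)+
  then have "compact K"
    unfolding K_def using compact_stt_polyhedron_bounded_depth by (intro compact_Int_closed)
  moreover have "append_below p0 \<in> K"
    using append_below_mem[OF p0(1)] D0 by (auto simp: K_def D0_def)
  then have "K \<noteq> {}" by blast
  moreover have "continuous_on K (\<lambda>p. fst p $ w)"
    by (rule continuous_intros)+
  ultimately obtain p where p: "p \<in> K" "\<And>y. y \<in> K \<Longrightarrow> fst p $ w \<le> fst y $ w"
    using continuous_attains_inf[of K "\<lambda>p. fst p $ w"] by blast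
  define q where "q = fst p"
  have q: "q \<in> depth_projection G'" "\<And>i. i \<noteq> w \<Longrightarrow> q $ i = d $ i" "q $ w \<le> D0 $ w"
    using p(1) by (auto simp: K_def depth_projection_def q_def)
  have fq: "forget q = d" using q(2) forget_iff by blast
  have "q extreme_point_of depth_projection G'"
  proof (rule extreme_point_of_linear_fibre[where M = forget and S = "depth_projection G"
        and F = "{\<lambda>D. D $ w}"])
    show "linear forget"
      by (rule linearI) (auto simp: forget_def vec_eq_iff)
    show "forget ` depth_projection G' \<subseteq> depth_projection G" by (rule forget_depth_projection)
    show "q \<in> depth_projection G'" by (rule q)
    show "forget q extreme_point_of depth_projection G" using d(1) fq by simp
    show "linear f" if "f \<in> {\<lambda>D. D $ w}" for f :: "real^'v \<Rightarrow> real"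
      using that by (auto intro: linearI)
  next
    fix f :: "real^'v \<Rightarrow> real" and x
    assume f: "f \<in> {\<lambda>D. D $ w}" and x: "x \<in> depth_projection G'" "forget x = forget q"
    obtain y where y: "y \<in> stt_polyhedron G'" "x = fst y"
      using x(1) by (auto simp: depth_projection_def)
    have xd: "\<forall>i. i \<noteq> w \<longrightarrow> x $ i = d $ i" using x(2) fq forget_iff by simp
    have "q $ w \<le> x $ w"
    \<comment> \<open>Below the cutoff, \<open>y\<close> competes in \<open>K\<close>; above it,
      \<open>x $ w\<close> exceeds \<open>D0 $ w\<close>, which is at least
      \<open>q $ w\<close>.\<close>
    proof (cases "x $ w \<le> D0 $ w")
      case True
      have "x $ i \<le> D0 $ i" for i
        using True xd D0 by (cases "i = w") auto
      then have "y \<in> K" using y xd by (simp add: K_def)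
      then show ?thesis using p(2) y(2) by (simp add: q_def)
    next
      case False
      then show ?thesis using q(3) by simp
    qed
    then show "f q \<le> f x" using f by simp
  next
    fix x assume x: "forget x = forget q" and "\<And>f. f \<in> {\<lambda>D. D $ w} \<Longrightarrow> f x = f q"
    then have "x $ w = q $ w" by simp
    moreover have "x $ i = q $ i" if "i \<noteq> w" for i
      using x fq forget_iff q(2) that by simp
    ultimately show "x = q" unfolding vec_eq_iff by metis
  qed
  moreover have "\<not> (\<forall>b\<in>Basis. q \<bullet> b \<in> \<int>)"
  proof
    assume "\<forall>b\<in>Basis. q \<bullet> b \<in> \<int>"
    then have int: "q $ i \<in> \<int>" for i
      unfolding ball_Basis_simps[where P = "\<lambda>y. y \<in> \<int>"] by simp
    have "d $ i \<in> \<int>" for i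
      using int[of i] q(2)[of i] dw by (cases "i = w") auto
    then show False
      using d(2) unfolding ball_Basis_simps[where P = "\<lambda>y. y \<in> \<int>"] by simp
  qed
  ultimately show ?thesis unfolding has_noninteger_vertex_def by blast
qed

end

section \<open>Chains of single extensions\<close>

text \<open>Induction peels off the last extension; \<open>pair_sym_digraph\<close> is carried along
  because the next insertion requires it.\<close>

lemma has_noninteger_vertex_relpow_single_extension:
  fixes U U' :: "'v::finite pair_pre_digraph"
  assumes "pair_sym_digraph U" and "(single_extension ^^ n) U U'"
  shows "pair_sym_digraph U' \<and>
    (has_noninteger_vertex (stt_polyhedron U) \<longrightarrow> has_noninteger_vertex (stt_polyhedron U')) \<and>
    (has_noninteger_vertex (depth_projection U) \<longrightarrow> has_noninteger_vertex (depth_projection U'))"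
  using assms(2)
proof (induction n arbitrary: U')
  case 0
  then show ?case using assms(1) by simp
next
  case (Suc n)
  then obtain V where V: "(single_extension ^^ n) U V" "single_extension V U'"
    by (auto elim: relpowp_Suc_E)
  have sym: "pair_sym_digraph V" using Suc.IH[OF V(1)] by simp
  obtain w u where "node_insertion V U' w u"
    using node_insertion_single_extension[OF sym V(2)] .
  then interpret node_insertion V U' w u .
  show ?case
    using Suc.IH[OF V(1)] pair_sym_digraph_single_extension[OF sym V(2)]
      has_noninteger_vertex_stt_polyhedron has_noninteger_vertex_depth_projection by blast
qed

theorem theorem3p12:
  fixes U U' :: "'v::finite pair_pre_digraph"
  assumes "undirected_tree U" and "U' extends U"
  shows "(has_noninteger_vertex (stt_polyhedron U) \<longrightarrow>
            has_noninteger_vertex (stt_polyhedron U')) \<and>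
         (has_noninteger_vertex (depth_projection U) \<longrightarrow>
            has_noninteger_vertex (depth_projection U'))"
proof -
  have "pair_graph U" using assms(1) by (simp add: undirected_tree_def)
  then have "pair_sym_digraph U" by (simp add: pair_graph_def pair_pseudo_graph_def)
  then show ?thesis
    using has_noninteger_vertex_relpow_single_extension assms(2) unfolding extends_def by blast
qed

end
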